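(* Let $k\geq 2$ and $L\geq 1$ be integers. For $n\ge 0$, call a word $w_1\cdots w_n\in[k]^n$ (where $[k]=\{1,\ldots,k\}$) a staircase graph word of $P_{n,L}$ if $|w_i-w_j|\leq 1$ for all $1\le i,j\le n$ with $|i-j|\leq L$, and let $f(x)=f_{k,L}(x)=\sum_{n\ge0}s_nx^n$ where $s_n$ is the number of such words of length $n$. Let $\phi=\left(1-\frac{x^{2L}-x}{x-1}\right)/(2x^{L})$ and $\beta=(1-x^{L})/(1-x)$, and let $U_m$ denote the Chebyshev polynomials of the second kind. Then \[f(x)=\frac{\beta}{1-2x-x^{L}}\left(1+(k-3)x+x\,\frac{r_{1}(x)U_{k-1}(\phi)+r_{2}(x)U_{k}(\phi)+r_{3}(x)}{r_{4}(x)U_{k-1}(\phi)+r_{5}(x)U_{k}(\phi)+r_{3}(x)}\right),\] where \begin{align*} r_{1}(x)&=(4\phi^{2}+2\phi-1)\beta^{2}-4(2\phi^{2}-1)\beta+4\phi^{2}-2(\phi+1),\\ r_{2}(x)&=-(1+2\phi)\beta^{2}+4\beta\phi-2(\phi-1),\\ r_{3}(x)&=-2(\phi-1)(\beta-1)-\beta^{2},\\ r_{4}(x)&=(2\phi^{2}-1)\beta^{2}-2(2\phi^{2}-\phi-1)\beta+2\phi(\phi-1),\\ r_{5}(x)&=2(\phi-1)(\beta-1)-\beta^{2}\phi. \end{align*}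
   Context: $P_{n,L}$ is the path graph on vertices $1,\ldots,n$ in which two vertices are adjacent when their distance is at most $L$; staircase graph words of $P_{n,L}$ are labelings by $[k]$ in which adjacent vertices have labels differing by at most $1$. The Chebyshev polynomials of the second kind are defined by $U_0(x)=1$, $U_1(x)=2x$, $U_{m+1}(x)=2xU_m(x)-U_{m-1}(x)$. The identity is an identity of rational functions (equivalently of formal power series in $x$). *)

theory Defs
  imports "HOL-Computational_Algebra.Computational_Algebra"
begin

text \<open>
  Words are lists; positions are counted from 0 instead of 1, which leaves the
  differences of positions unchanged. Differences are taken in \<^typ>\<open>int\<close>, since
  subtraction on \<^typ>\<open>nat\<close> truncates.
\<close>

definition staircase_words :: "nat \<Rightarrow> nat \<Rightarrow> nat \<Rightarrow> nat list set" where
  "staircase_words k L n =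
    {w. length w = n \<and> set w \<subseteq> {1..k} \<and>
        (\<forall>i<n. \<forall>j<n. \<bar>int i - int j\<bar> \<le> int L \<longrightarrow> \<bar>int (w ! i) - int (w ! j)\<bar> \<le> 1)}"

definition staircase_gf :: "nat \<Rightarrow> nat \<Rightarrow> rat fps" where
  "staircase_gf k L = Abs_fps (\<lambda>n. of_nat (card (staircase_words k L n)))"

fun chebyshev_U :: "nat \<Rightarrow> 'a :: comm_ring_1 \<Rightarrow> 'a" where
  "chebyshev_U 0 x = 1"
| "chebyshev_U (Suc 0) x = 2 * x"
| "chebyshev_U (Suc (Suc m)) x = 2 * x * chebyshev_U (Suc m) x - chebyshev_U m x"

text \<open>
  The rational functions are taken in the field of formal Laurent series over the
  rationals, which contains both the rational functions (\<open>phi\<close> has a pole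
  at 0) and the power series \<^const>\<open>staircase_gf\<close>. Here \<^const>\<open>fls_X\<close> is the indeterminate.
\<close>

definition phi :: "nat \<Rightarrow> rat fls" where
  "phi L = (1 - (fls_X ^ (2 * L) - fls_X) / (fls_X - 1)) / (2 * fls_X ^ L)"

definition beta :: "nat \<Rightarrow> rat fls" where
  "beta L = (1 - fls_X ^ L) / (1 - fls_X)"

definition r1 :: "nat \<Rightarrow> rat fls" where
  "r1 L = (4 * phi L ^ 2 + 2 * phi L - 1) * beta L ^ 2
        - 4 * (2 * phi L ^ 2 - 1) * beta L + 4 * phi L ^ 2 - 2 * (phi L + 1)"

definition r2 :: "nat \<Rightarrow> rat fls" where
  "r2 L = - (1 + 2 * phi L) * beta L ^ 2 + 4 * beta L * phi L - 2 * (phi L - 1)"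

definition r3 :: "nat \<Rightarrow> rat fls" where
  "r3 L = - 2 * (phi L - 1) * (beta L - 1) - beta L ^ 2"

definition r4 :: "nat \<Rightarrow> rat fls" where
  "r4 L = (2 * phi L ^ 2 - 1) * beta L ^ 2
        - 2 * (2 * phi L ^ 2 - phi L - 1) * beta L + 2 * phi L * (phi L - 1)"

definition r5 :: "nat \<Rightarrow> rat fls" where
  "r5 L = 2 * (phi L - 1) * (beta L - 1) - beta L ^ 2 * phi L"

end

theory Submission
  imports Defs
begin

text \<open>
  Words are built letter by letter at the front. The possible continuations depend only on whether the
  \<open>L\<close> newest letters are all equal to some \<open>a\<close> (generating function \<open>A\<^sub>a\<close>), or whether the word has
  just switched from \<open>a\<close> to a neighbour \<open>b\<close> (generating function \<open>E\<^sub>a\<^sub>b\<close>; as long as \<open>a\<close> remains in the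
  window, only \<open>a\<close> and \<open>b\<close> may be appended). With \<open>c = \<beta> - 1\<close> this gives
  \<open>A\<^sub>a = 1 + x (A\<^sub>a + E\<^sub>a\<^sub>,\<^sub>a\<^sub>-\<^sub>1 + E\<^sub>a\<^sub>,\<^sub>a\<^sub>+\<^sub>1)\<close>, \<open>x E\<^sub>a\<^sub>b = c (1 + x E\<^sub>b\<^sub>a) + x\<^sup>L A\<^sub>b\<close> and \<open>f = 1 + x \<Sum> A\<^sub>a\<close>.
  Eliminating \<open>E\<close> yields \<open>A\<^sub>a\<^sub>-\<^sub>1 + A\<^sub>a\<^sub>+\<^sub>1 = 2 \<phi> A\<^sub>a - \<beta>\<^sup>2 / x\<^sup>L\<close>, a Chebyshev recurrence with boundary
  conditions.
\<close>

section \<open>Staircase words built at the front\<close>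

fun ok :: "nat \<Rightarrow> nat list \<Rightarrow> bool" where
  "ok L [] = True"
| "ok L (x # p) = ((\<forall>c\<in>set (take L p). \<bar>int x - int c\<bar> \<le> 1) \<and> ok L p)"

text \<open>The condition is symmetric, so each pair is checked once, when its newer letter is
  prepended; \<open>take L p\<close> holds exactly the letters of \<open>p\<close> within distance
  \<open>L\<close> of \<open>x\<close>.\<close>

lemma ok_iff_nth:
  "ok L w \<longleftrightarrow> (\<forall>i<length w. \<forall>j<length w. \<bar>int i - int j\<bar> \<le> int L \<longrightarrow> \<bar>int (w ! i) - int (w ! j)\<bar> \<le> 1)"
  (is "_ \<longleftrightarrow> ?P w")
proof (induction w)
  case Nil
  then show ?case by simp
next
  case (Cons x p)
  have "(\<forall>c\<in>set (take L p). \<bar>int x - int c\<bar> \<le> 1) \<longleftrightarrow>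
      (\<forall>j<length p. j < L \<longrightarrow> \<bar>int x - int (p ! j)\<bar> \<le> 1)"
    by (auto simp: all_set_conv_all_nth)
  moreover have "?P (x # p) \<longleftrightarrow> (\<forall>j<length p. j < L \<longrightarrow> \<bar>int x - int (p ! j)\<bar> \<le> 1) \<and> ?P p"
    (is "?l \<longleftrightarrow> ?r")
  proof
    assume l: ?l
    show ?r
    proof (intro conjI allI impI)
      fix j assume "j < length p" "j < L"
      then show "\<bar>int x - int (p ! j)\<bar> \<le> 1"
        using l[rule_format, of 0 "Suc j"] by simp
    next
      fix i j assume "i < length p" "j < length p" "\<bar>int i - int j\<bar> \<le> int L"
      then show "\<bar>int (p ! i) - int (p ! j)\<bar> \<le> 1"
        using l[rule_format, of "Suc i" "Suc j"] by simp
    qed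
  next
    assume r: ?r
    show ?l
    proof (intro allI impI)
      fix i j assume ij: "i < length (x # p)" "j < length (x # p)" "\<bar>int i - int j\<bar> \<le> int L"
      show "\<bar>int ((x # p) ! i) - int ((x # p) ! j)\<bar> \<le> 1"
      proof (cases i; cases j)
        fix j' assume "i = 0" "j = Suc j'"
        then show ?thesis using r ij by simp
      next
        fix i' assume "i = Suc i'" "j = 0"
        then show ?thesis using r ij by (simp add: abs_minus_commute)
      next
        fix i' j' assume "i = Suc i'" "j = Suc j'"
        then show ?thesis using r ij by simp
      qed simp
    qed
  qed
  ultimately show ?case using Cons.IH by simp
qed

text \<open>
  How a word may be extended depends only on the distances at which each letter last occurred, that is,
  on the sets of letters of its short prefixes.
\<close>

lemma ok_append_cong:
  assumes "ok L p \<longleftrightarrow> ok L q" and "\<And>i. i \<le> L \<Longrightarrow> set (take i p) = set (take i q)"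
  shows "ok L (w @ p) \<longleftrightarrow> ok L (w @ q)"
proof -
  have "(ok L (w @ p) \<longleftrightarrow> ok L (w @ q)) \<and> (\<forall>i\<le>L. set (take i (w @ p)) = set (take i (w @ q)))"
  proof (induction w)
    case Nil
    then show ?case using assms by simp
  next
    case (Cons x w)
    then show ?case by (auto simp: take_Cons' simp del: take_append)
  qed
  then show ?thesis by blast
qed

section \<open>Generating functions of extensions and their linear system\<close>

definition ext_gf :: "nat \<Rightarrow> nat \<Rightarrow> nat list \<Rightarrow> rat fps" where
  "ext_gf k L p = Abs_fps (\<lambda>n. of_nat (card {w. length w = n \<and> set w \<subseteq> {1..k} \<and> ok L (w @ p)}))"

lemma staircase_gf_eq_ext_gf: "staircase_gf k L = ext_gf k L []"
proof -
  have "staircase_words k L n = {w. length w = n \<and> set w \<subseteq> {1..k} \<and> ok L w}" for n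
    by (auto simp: staircase_words_def ok_iff_nth)
  then show ?thesis by (simp add: staircase_gf_def ext_gf_def)
qed

lemma ext_gf_cong:
  assumes "ok L p \<longleftrightarrow> ok L q" and "\<And>i. i \<le> L \<Longrightarrow> set (take i p) = set (take i q)"
  shows "ext_gf k L p = ext_gf k L q"
  using ok_append_cong[OF assms] by (simp add: ext_gf_def)

lemma ok_appendD: "ok L (w @ p) \<Longrightarrow> ok L p"
  by (induction w) auto

lemma ext_gf_not_ok: "\<not> ok L p \<Longrightarrow> ext_gf k L p = 0"
proof -
  assume "\<not> ok L p"
  then have e: "{w. length w = n \<and> set w \<subseteq> {1..k} \<and> ok L (w @ p)} = {}" for n
    using ok_appendD by auto
  show ?thesis
    unfolding ext_gf_def e by (simp add: fps_eq_iff)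
qed

lemma ext_gf_rec:
  assumes "ok L p"
  shows "ext_gf k L p = 1 + fps_X * (\<Sum>x=1..k. ext_gf k L (x # p))"
proof (rule fps_ext)
  fix n
  define W where "W q n = {w. length w = n \<and> set w \<subseteq> {1..k} \<and> ok L (w @ q)}" for q n
  have fin: "finite (W q n)" for q n
    by (rule finite_subset[OF _ finite_lists_length_eq[of "{1..k}" n]]) (auto simp: W_def)
  have nth: "ext_gf k L q $ n = of_nat (card (W q n))" for q n
    by (simp add: ext_gf_def W_def)
  show "ext_gf k L p $ n = (1 + fps_X * (\<Sum>x=1..k. ext_gf k L (x # p))) $ n"
  proof (cases n)
    case 0
    have "W p 0 = {[]}" using assms by (auto simp: W_def)
    then show ?thesis by (simp add: 0 nth)
  next
    case (Suc m)
    \<comment> \<open>The letter split off is the last of the word: it touches \<open>p\<close>, so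
      the remaining letters extend \<open>x # p\<close>.\<close>
    have "W p (Suc m) = (\<Union>x\<in>{1..k}. (\<lambda>w. w @ [x]) ` W (x # p) m)" (is "_ = ?R")
    proof
      show "W p (Suc m) \<subseteq> ?R"
      proof
        fix w assume w: "w \<in> W p (Suc m)"
        then obtain v x where v: "w = v @ [x]"
          by (cases w rule: rev_cases) (auto simp: W_def)
        show "w \<in> ?R" using w by (auto simp: v W_def)
      qed
    qed (auto simp: W_def)
    also have "card \<dots> = (\<Sum>x=1..k. card ((\<lambda>w. w @ [x]) ` W (x # p) m))"
      by (rule card_UN_disjoint) (auto simp: fin)
    also have "\<dots> = (\<Sum>x=1..k. card (W (x # p) m))"
      by (intro sum.cong refl card_image) (auto simp: inj_on_def)
    finally show ?thesis by (simp add: Suc nth fps_sum_nth)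
  qed
qed

lemma ok_replicate: "ok L (replicate n a)"
  by (induction n) (auto dest: in_set_takeD)

lemma ok_two_blocks: "\<bar>int a - int b\<bar> \<le> 1 \<Longrightarrow> ok L (replicate m b @ replicate n a)"
  by (induction m) (auto simp: ok_replicate dest!: in_set_takeD)

text \<open>Nonempty prefixes of \<open>[a]\<close> and of \<open>replicate L a\<close> all have
  letter set \<open>{a}\<close>, so a single first letter constrains as much as a full
  block.\<close>

lemma ext_gf_start:
  assumes "L \<ge> 1"
  shows "ext_gf k L [] = 1 + fps_X * (\<Sum>a=1..k. ext_gf k L (replicate L a))"
proof -
  have "ext_gf k L [a] = ext_gf k L (replicate L a)" for a
    using assms by (intro ext_gf_cong) (auto simp: ok_replicate take_Cons' min_def)
  then show ?thesis by (subst ext_gf_rec) auto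
qed

lemma ext_gf_block:
  assumes "L \<ge> 1" "a \<in> {1..k}"
  shows "ext_gf k L (replicate L a) = 1 + fps_X * (ext_gf k L (replicate L a)
     + (if a = 1 then 0 else ext_gf k L ((a - 1) # replicate L a))
     + (if a = k then 0 else ext_gf k L ((a + 1) # replicate L a)))"
proof -
  let ?g = "\<lambda>x. ext_gf k L (x # replicate L a)"
  have aa: "?g a = ext_gf k L (replicate L a)"
    using assms ok_replicate[of L "Suc L" a]
    by (intro ext_gf_cong) (auto simp: ok_replicate take_Cons' min_def)
  have z: "?g x = 0" if "x \<noteq> a" "x \<noteq> a - 1" "x \<noteq> a + 1" for x
    using that assms by (intro ext_gf_not_ok) auto
  have "(\<Sum>x=1..k. ?g x) = (\<Sum>x\<in>{a} \<union> (if a = 1 then {} else {a - 1}) \<union> (if a = k then {} else {a + 1}). ?g x)"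
    using assms by (intro sum.mono_neutral_right ballI z) (auto split: if_splits)
  also have "\<dots> = ?g a + (if a = 1 then 0 else ?g (a - 1)) + (if a = k then 0 else ?g (a + 1))"
    using assms by (auto simp: algebra_simps)
  finally show ?thesis by (subst ext_gf_rec) (simp_all add: ok_replicate aa)
qed

text \<open>A window containing both \<open>a\<close> and \<open>b\<close> admits only these two
  letters. A new \<open>a\<close> hides the older ones behind a nearer occurrence, giving the state
  of a fresh switch from \<open>b\<close> to \<open>a\<close>.\<close>

lemma ext_gf_two_blocks:
  assumes "\<bar>int a - int b\<bar> = 1" "a \<in> {1..k}" "b \<in> {1..k}" "1 \<le> j" "j < L"
  shows "ext_gf k L (replicate j b @ replicate L a) =
     1 + fps_X * (ext_gf k L (replicate (Suc j) b @ replicate L a) + ext_gf k L (a # replicate L b))"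
proof -
  let ?p = "replicate j b @ replicate L a"
  let ?g = "\<lambda>x. ext_gf k L (x # ?p)"
  have ok: "ok L ?p" using assms by (intro ok_two_blocks) auto
  have ab: "a \<noteq> b" using assms by auto
  have t: "set (take L ?p) = {a, b}"
    using assms by (auto simp: min_def)
  have oka: "ok L (a # ?p)" using ok assms unfolding ok.simps t by auto
  have a: "?g a = ext_gf k L (a # replicate L b)"
  proof (rule ext_gf_cong)
    show "ok L (a # ?p) \<longleftrightarrow> ok L (a # replicate L b)"
      using oka ok_replicate[of L L b] assms by auto
    show "set (take i (a # ?p)) = set (take i (a # replicate L b))" if "i \<le> L" for i
      using assms that by (cases i) (auto simp: min_def)
  qed
  have z: "?g x = 0" if "x \<noteq> a" "x \<noteq> b" for x
  proof (rule ext_gf_not_ok)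
    show "\<not> ok L (x # ?p)" using that assms(1) unfolding ok.simps t by auto
  qed
  have "(\<Sum>x=1..k. ?g x) = (\<Sum>x\<in>{b, a}. ?g x)"
    using assms by (intro sum.mono_neutral_right) (auto intro!: z)
  also have "\<dots> = ?g b + ?g a" using ab by simp
  finally show ?thesis by (subst ext_gf_rec[OF ok]) (simp add: a)
qed

text \<open>While the run of \<open>b\<close> is shorter than \<open>L\<close>, the word ends,
  switches back to \<open>a\<close>, or lengthens the run; the geometric sum collects the first two
  cases. At length \<open>L\<close> the old \<open>a\<close>s have left the window.\<close>

lemma ext_gf_step:
  assumes "\<bar>int a - int b\<bar> = 1" "a \<in> {1..k}" "b \<in> {1..k}" "L \<ge> 1"
  shows "ext_gf k L (b # replicate L a) =
     (\<Sum>i<L-1. fps_X ^ i) * (1 + fps_X * ext_gf k L (a # replicate L b))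
     + fps_X ^ (L - 1) * ext_gf k L (replicate L b)"
proof -
  let ?R = "\<lambda>j. ext_gf k L (replicate j b @ replicate L a)"
  have "?R 1 = (\<Sum>i<m. fps_X ^ i) * (1 + fps_X * ext_gf k L (a # replicate L b))
     + fps_X ^ m * ?R (Suc m)" if "m < L" for m
    using that
  proof (induction m)
    case 0
    then show ?case by simp
  next
    case (Suc m)
    have "?R (Suc m) = 1 + fps_X * (?R (Suc (Suc m)) + ext_gf k L (a # replicate L b))"
      using Suc.prems assms by (intro ext_gf_two_blocks) auto
    with Suc show ?case by (simp add: algebra_simps del: replicate_Suc)
  qed
  from this[of "L - 1"] have "?R 1 = (\<Sum>i<L-1. fps_X ^ i) * (1 + fps_X * ext_gf k L (a # replicate L b))
     + fps_X ^ (L-1) * ?R L" using assms(4) by (simp del: replicate_Suc)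
  moreover have "?R L = ext_gf k L (replicate L b)"
    using assms by (intro ext_gf_cong) (auto simp: ok_replicate intro!: ok_two_blocks)
  ultimately show ?thesis by simp
qed

section \<open>Chebyshev recurrences and the solution of the linear system\<close>

text \<open>The form \<open>s^2 - 2*x*s*t + t^2\<close> is invariant under the recurrence step from
  \<open>(s, t)\<close> to \<open>(t, 2*x*t - s)\<close>.\<close>

lemma chebyshev_U_Pell:
  "chebyshev_U (Suc n) x ^ 2 - 2 * x * chebyshev_U n x * chebyshev_U (Suc n) x + chebyshev_U n x ^ 2 = 1"
proof (induction n)
  case (Suc n)
  then show ?case by (simp add: algebra_simps power2_eq_square)
qed (simp add: power2_eq_square)

text \<open>
  The sum is computed without solving for \<open>B\<close>: summing the recurrence reduces it to \<open>B 1 + B k\<close>, and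
  that is found from the constancy of the Wronskian of \<open>B\<close> with the palindromic solution
  \<open>h a = U\<^bsub>a-1\<^esub> + U\<^bsub>k-a\<^esub>\<close>.
\<close>

lemma boundary_value_sum:
  fixes B :: "nat \<Rightarrow> 'a::field" and p c g :: 'a
  assumes two: "(2::'a) \<noteq> 0" and k: "k \<ge> 1"
    and rec: "\<And>a. a < k \<Longrightarrow> B a + B (a + 2) = 2 * p * B (a + 1)"
    and left: "B 0 + c * B 1 = - g"
    and right: "B (k + 1) + c * B k = - g"
  shows "(chebyshev_U k p + c * chebyshev_U (k - 1) p + c) * (p - 1) * (\<Sum>a=1..k. B a)
       = - g * (chebyshev_U k p - chebyshev_U (k - 1) p - 1)"
proof -
  \<comment> \<open>\<open>W 0\<close> stands for \<open>U\<close> at index \<open>-1\<close>, so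
    the recurrence holds from index 0 on.\<close>
  define W where "W n = (case n of 0 \<Rightarrow> 0 | Suc m \<Rightarrow> chebyshev_U m p)" for n
  define h where "h a = W a + W (k + 1 - a)" for a
  define u v where "u = chebyshev_U (k - 1) p" and "v = chebyshev_U k p"
  have W: "W n + W (n + 2) = 2 * p * W (n + 1)" for n
    by (cases n) (simp_all add: W_def)
  have h_rec: "h a + h (a + 2) = 2 * p * h (a + 1)" if "a < k" for a
  proof -
    have "k + 1 - a = (k + 1 - (a + 2)) + 2" "k + 1 - (a + 1) = (k + 1 - (a + 2)) + 1"
      using that by simp_all
    then show ?thesis
      using W[of a] W[of "k + 1 - (a + 2)"] unfolding h_def by (simp add: algebra_simps)
  qed
  have wronskian: "h a * B (a + 1) - h (a + 1) * B a = h 0 * B 1 - h 1 * B 0" if "a \<le> k" for a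
    using that
  proof (induction a)
    case (Suc a)
    have B2: "B (a + 2) = 2 * p * B (a + 1) - B a" and h2: "h (a + 2) = 2 * p * h (a + 1) - h a"
      using rec[of a] h_rec[of a] Suc.prems by (simp_all add: eq_diff_eq add.commute)
    have "h (a + 1) * B (a + 2) - h (a + 2) * B (a + 1) = h a * B (a + 1) - h (a + 1) * B a"
      unfolding B2 h2 by (simp add: algebra_simps)
    then show ?case using Suc by simp
  qed simp
  have "Suc 0 \<le> k" using k by simp
  then obtain k' where k': "k = Suc k'" by (cases k) auto
  have h_vals: "h 0 = v" "h 1 = 1 + u" "h k = 1 + u" "h (k + 1) = v"
    by (simp_all add: h_def W_def u_def v_def k')
  have sums: "(\<Sum>a<n. B a + B (a + 2)) = 2 * (\<Sum>a=1..n. B a) + B 0 - B 1 - B n + B (n + 1)" for n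
    by (induction n) (simp_all add: algebra_simps)
  have "(\<Sum>a<k. B a + B (a + 2)) = (\<Sum>a<k. 2 * p * B (a + 1))"
    using rec by (intro sum.cong) auto
  also have "\<dots> = 2 * p * (\<Sum>a=1..k. B a)"
    by (simp add: sum_distrib_left sum.atLeast1_atMost_eq)
  finally have S: "2 * p * (\<Sum>a=1..k. B a) = 2 * (\<Sum>a=1..k. B a) + B 0 - B 1 - B k + B (k + 1)"
    by (simp only: sums)
  \<comment> \<open>As \<open>h\<close> is palindromic, only the sums \<open>B 0 + B (k + 1)\<close>
    and \<open>B 1 + B k\<close> enter this relation.\<close>
  have M: "(1 + u) * B (k + 1) - v * B k = v * B 1 - (1 + u) * B 0"
    using wronskian[of k] by (simp add: h_vals[simplified])
  have B0: "B 0 = - g - c * B 1" and Bk: "B (k + 1) = - g - c * B k"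
    using left right by (simp_all add: eq_diff_eq)
  define S' where "S' = (\<Sum>a=1..k. B a)"
  have M': "(v + c * u + c) * (B 1 + B k) = - 2 * g * (1 + u)"
    using M unfolding B0 Bk by algebra
  have S1: "2 * ((p - 1) * S') = - ((1 + c) * (B 1 + B k) + 2 * g)"
    using S unfolding B0 Bk S'_def[symmetric] by algebra
  have "2 * ((v + c * u + c) * (p - 1) * S') = 2 * (- g * (v - u - 1))"
    using M' S1 by algebra
  then show ?thesis using two unfolding u_def v_def S'_def by (metis mult_left_cancel)
qed

text \<open>
  Eliminating \<open>E\<close> leaves a second-order recurrence for \<open>A\<close>. Virtual values \<open>A' 0\<close> and \<open>A' (k + 1)\<close>,
  chosen to make the missing terms \<open>E 1 0\<close> and \<open>E k (k + 1)\<close> vanish, extend it to the two ends;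
  subtracting the constant solution \<open>s\<close> makes it homogeneous.
\<close>

lemma coupled_system_sum:
  fixes A :: "nat \<Rightarrow> 'a::field" and E :: "nat \<Rightarrow> nat \<Rightarrow> 'a" and x X c p :: 'a and k :: nat
  defines "u \<equiv> chebyshev_U (k - 1) p" and "v \<equiv> chebyshev_U k p" and "\<beta> \<equiv> 1 + c"
  assumes two: "(2::'a) \<noteq> 0" and k: "k \<ge> 1"
    and A: "\<And>a. a \<in> {1..k} \<Longrightarrow> A a = 1 + x * (A a + (if a = 1 then 0 else E a (a - 1))
                + (if a = k then 0 else E a (a + 1)))"
    and E: "\<And>a b. a \<in> {1..k} \<Longrightarrow> b \<in> {1..k} \<Longrightarrow> \<bar>int a - int b\<bar> = 1 \<Longrightarrow>
                x * E a b = c * (1 + x * E b a) + X * A b"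
    and beta: "\<beta> * (1 - x) = 1 - X"
    and phi: "2 * p * X * (1 - x) = 1 - 2 * x + X ^ 2"
    and nz: "x \<noteq> 1" "X \<noteq> 0" "c ^ 2 \<noteq> 1" "1 - 2 * x - X \<noteq> 0" "v + c * u + c \<noteq> 0"
  shows "(1 - 2 * x - X) * (\<Sum>a=1..k. A a)
       = of_nat k * \<beta> - (2 * (p - 1) * c + \<beta> ^ 2) * (v - u - 1) / ((p - 1) * (v + c * u + c))"
proof -
  define e where "e = 1 - 2 * x - X"
  have x1: "1 - x \<noteq> 0" using nz by simp
  have e: "\<beta> * e = 2 * X * (p - 1)"
  proof -
    have "(1 - x) * (\<beta> * e) = (1 - x) * (2 * X * (p - 1))"
      using beta phi unfolding e_def by algebra
    then show ?thesis using x1 by simp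
  qed
  have p: "(1 - x) * (1 - c ^ 2) - 2 * c * X = 2 * p * X"
  proof -
    have "(1 - x) * ((1 - x) * (1 - c ^ 2) - 2 * c * X) = (1 - x) * (2 * p * X)"
      using beta phi unfolding \<beta>_def by algebra
    then show ?thesis using x1 by simp
  qed
  have "\<beta> \<noteq> 0" using nz(3) unfolding \<beta>_def by algebra
  then have p1: "p - 1 \<noteq> 0" using e nz(4) by (auto simp: e_def)
  define A' where "A' a = (if a = 0 then - c * A 1 - c * \<beta> / X
      else if a = k + 1 then - c * A k - c * \<beta> / X else A a)" for a
  \<comment> \<open>Solving the two equations for \<open>E a b\<close> and \<open>E b a\<close>
    gives \<open>(1 - c^2) * x * E a b\<close> as this expression, which still makes sense at the
    virtual indices.\<close>
  define G where "G a b = c * \<beta> + X * (A' b + c * A' a)" for a b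
  have A'_in: "A' a = A a" if "a \<in> {1..k}" for a using that by (simp add: A'_def)
  have G_in: "G a b = (1 - c ^ 2) * (x * E a b)"
    if "a \<in> {1..k}" "b \<in> {1..k}" "\<bar>int a - int b\<bar> = 1" for a b
  proof -
    have "x * E a b = c * (1 + x * E b a) + X * A b" "x * E b a = c * (1 + x * E a b) + X * A a"
      using that by (auto intro!: E)
    then show ?thesis unfolding G_def \<beta>_def A'_in[OF that(1)] A'_in[OF that(2)] by algebra
  qed
  have G_out: "G 1 0 = 0" "G k (k + 1) = 0"
    using nz(2) k by (simp_all add: G_def A'_def field_simps)
  have bal: "(1 - x) * (1 - c ^ 2) * A' (a + 1) = (1 - c ^ 2) + G (a + 1) a + G (a + 1) (a + 2)"
    if "a < k" for a
  proof -
    have l: "G (a + 1) a = (1 - c ^ 2) * (x * (if a + 1 = 1 then 0 else E (a + 1) a))"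
      using G_in[of "a + 1" a] G_out(1) that by (cases "a = 0") auto
    have r: "G (a + 1) (a + 2) = (1 - c ^ 2) * (x * (if a + 1 = k then 0 else E (a + 1) (a + 2)))"
      using G_in[of "a + 1" "a + 2"] G_out(2) that by (cases "a + 1 = k") auto
    have "A (a + 1) = 1 + x * (A (a + 1) + (if a + 1 = 1 then 0 else E (a + 1) a)
       + (if a + 1 = k then 0 else E (a + 1) (a + 2)))"
      using A[of "a + 1"] that by (auto split: if_splits)
    moreover have "A' (a + 1) = A (a + 1)" using that by (intro A'_in) auto
    ultimately show ?thesis unfolding l r by algebra
  qed
  have A'_rec: "X * (A' a + A' (a + 2)) = 2 * p * X * A' (a + 1) - \<beta> ^ 2" if "a < k" for a
    using bal[OF that] p unfolding G_def \<beta>_def by algebra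
  \<comment> \<open>A constant solution of \<open>A'_rec\<close> needs
    \<open>2 * X * (p - 1) * s = \<beta>^2\<close>; the identity \<open>e\<close> turns this into
    \<open>\<beta> / e\<close>.\<close>
  define s where "s = \<beta> / e"
  define B where "B a = A' a - s" for a
  define g where "g = \<beta> * (c / X + s)"
  have e0: "e \<noteq> 0" using nz by (simp add: e_def)
  have s: "s * e = \<beta>" using e0 by (simp add: s_def)
  have s': "2 * X * (p - 1) * s = \<beta> ^ 2"
    unfolding e[symmetric] using s by (simp add: power2_eq_square mult_ac)
  have B_rec: "B a + B (a + 2) = 2 * p * B (a + 1)" if "a < k" for a
  proof -
    have "X * (B a + B (a + 2)) = X * (2 * p * B (a + 1))"
      using A'_rec[OF that] s' unfolding B_def by algebra
    then show ?thesis using nz(2) by simp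
  qed
  have B_left: "B 0 + c * B 1 = - g"
    using k by (simp add: B_def A'_def g_def \<beta>_def algebra_simps)
  have B_right: "B (k + 1) + c * B k = - g"
    using k by (simp add: B_def A'_def g_def \<beta>_def algebra_simps)
  have g: "g * e = 2 * (p - 1) * c + \<beta> ^ 2"
  proof -
    have "X * (g * e) = \<beta> * (c * e + X * (s * e))"
      using nz(2) by (simp add: g_def field_simps)
    also have "\<dots> = c * (\<beta> * e) + X * \<beta> ^ 2"
      unfolding s by (simp add: algebra_simps power2_eq_square)
    also have "\<dots> = X * (2 * (p - 1) * c + \<beta> ^ 2)"
      unfolding e by (simp add: algebra_simps)
    finally show ?thesis using nz(2) by simp
  qed
  have sum: "(v + c * u + c) * (p - 1) * (\<Sum>a=1..k. B a) = - g * (v - u - 1)"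
    unfolding u_def v_def using boundary_value_sum[OF two k B_rec B_left B_right] .
  have "(\<Sum>a=1..k. A a) = (\<Sum>a=1..k. B a + s)"
    by (intro sum.cong) (auto simp: B_def A'_in)
  then have "e * (\<Sum>a=1..k. A a) = of_nat k * \<beta> + e * (\<Sum>a=1..k. B a)"
    using s by (simp add: sum.distrib algebra_simps)
  moreover have "e * (\<Sum>a=1..k. B a) = - ((2 * (p - 1) * c + \<beta> ^ 2) * (v - u - 1)) / ((p - 1) * (v + c * u + c))"
  proof -
    have "(e * (\<Sum>a=1..k. B a)) * ((p - 1) * (v + c * u + c)) = - ((2 * (p - 1) * c + \<beta> ^ 2) * (v - u - 1))"
      using sum g by algebra
    moreover have "(p - 1) * (v + c * u + c) \<noteq> 0" using p1 nz(5) by simp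
    ultimately show ?thesis by (simp only: eq_divide_eq not_False_eq_True if_True)
  qed
  ultimately show ?thesis by (simp add: e_def)
qed

text \<open>
  The solution of the linear system has denominator \<open>v + c u + c\<close>, the paper's formula has \<open>D\<close>;
  they are only reconciled modulo the Pell relation, with cofactor \<open>K\<close> (the coefficient of \<open>v\<^sup>2\<close>).
\<close>

lemma denominators_agree:
  fixes p b u v :: "'a::comm_ring_1"
  assumes "v ^ 2 - 2 * p * u * v + u ^ 2 = 1"
  defines "c \<equiv> b - 1"
  defines "q3 \<equiv> - 2 * (p - 1) * (b - 1) - b ^ 2"
  defines "N \<equiv> ((4 * p ^ 2 + 2 * p - 1) * b ^ 2 - 4 * (2 * p ^ 2 - 1) * b + 4 * p ^ 2 - 2 * (p + 1)) * u
        + (- (1 + 2 * p) * b ^ 2 + 4 * b * p - 2 * (p - 1)) * v + q3"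
    and "D \<equiv> ((2 * p ^ 2 - 1) * b ^ 2 - 2 * (2 * p ^ 2 - p - 1) * b + 2 * p * (p - 1)) * u
        + (2 * (p - 1) * (b - 1) - b ^ 2 * p) * v + q3"
  shows "(p - 1) * (v + c * u + c) * (b * N - 2 * c * D) = q3 * (v - u - 1) * D"
proof -
  define K where "K = (p - 1) * (b * (- (1 + 2 * p) * b ^ 2 + 4 * b * p - 2 * (p - 1))
      - 2 * c * (2 * (p - 1) * (b - 1) - b ^ 2 * p)) - q3 * (2 * (p - 1) * (b - 1) - b ^ 2 * p)"
  have "(p - 1) * (v + c * u + c) * (b * N - 2 * c * D) - q3 * (v - u - 1) * D
      = K * (v ^ 2 - 2 * p * u * v + u ^ 2 - 1)"
    unfolding N_def D_def c_def q3_def K_def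
    by (simp add: algebra_simps power2_eq_square)
  then show ?thesis using assms(1) by simp
qed

section \<open>Leading terms of Laurent series at 0\<close>

text \<open>
  Power series with prescribed constant term, used to show that the denominators do not vanish although
  \<open>phi\<close> has a pole.
\<close>

definition regular :: "rat \<Rightarrow> rat fls \<Rightarrow> bool" where
  "regular a f \<longleftrightarrow> (\<exists>g. f = fps_to_fls g \<and> fps_nth g 0 = a)"

lemma regularI: "fps_nth g 0 = a \<Longrightarrow> regular a (fps_to_fls g)"
  by (auto simp: regular_def)

lemma regular_add: "regular a f \<Longrightarrow> regular b g \<Longrightarrow> regular (a + b) (f + g)"
  unfolding regular_def by (metis fps_to_fls_plus fps_add_nth)

lemma regular_diff: "regular a f \<Longrightarrow> regular b g \<Longrightarrow> regular (a - b) (f - g)"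
  unfolding regular_def by (metis fps_to_fls_minus fps_sub_nth)

lemma regular_mult: "regular a f \<Longrightarrow> regular b g \<Longrightarrow> regular (a * b) (f * g)"
  unfolding regular_def by (metis fls_times_fps_to_fls fps_mult_nth_0)

lemma regular_power: "regular a f \<Longrightarrow> regular (a ^ n) (f ^ n)"
  unfolding regular_def by (metis fps_to_fls_power fps_nth_power_0)

lemma regular_1: "regular 1 1"
  using regularI[of 1 1] by simp

lemma regular_numeral: "regular (numeral n) (numeral n)"
  using regularI[of "numeral n" "numeral n"] by simp

lemma regular_X: "regular 0 fls_X"
  using regularI[of fps_X 0] by simp

lemma regular_sum_power: "n \<ge> 1 \<Longrightarrow> regular 1 (\<Sum>i<n. fls_X ^ i)"
proof (induction n rule: dec_induct)
  case base
  then show ?case using regular_1 by simp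
next
  case (step n)
  then show ?case
    using regular_add[OF step.IH regular_power[OF regular_X, of n]] by (simp add: power_0_left)
qed

lemmas regular_intros = regular_add regular_diff regular_mult regular_power regular_1
  regular_numeral regular_X

lemma regular_nonzero: "regular a f \<Longrightarrow> a \<noteq> 0 \<Longrightarrow> f \<noteq> 0"
  by (auto simp: regular_def)

lemma fls_X_neq_1: "(fls_X :: rat fls) \<noteq> 1"
  using regular_nonzero[OF regular_diff[OF regular_1 regular_X]] by auto

lemma beta_eq_sum: "beta L = (\<Sum>i<L. fls_X ^ i)"
  unfolding beta_def one_diff_power_eq using fls_X_neq_1 by simp

lemma phi_mult: "L \<ge> 1 \<Longrightarrow> 2 * phi L * fls_X ^ L = 1 - fls_X * (\<Sum>i<2 * L - 1. fls_X ^ i)"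
proof -
  assume L: "L \<ge> 1"
  have "(1 - fls_X) * (fls_X * (\<Sum>i<2 * L - 1. fls_X ^ i)) = fls_X - (fls_X ^ Suc (2 * L - 1) :: rat fls)"
    unfolding mult.left_commute[of "1 - fls_X"] one_diff_power_eq[symmetric]
    by (simp add: right_diff_distrib)
  also have "Suc (2 * L - 1) = 2 * L" using L by simp
  finally have "(fls_X ^ (2 * L) - fls_X) / (fls_X - 1) = fls_X * (\<Sum>i<2 * L - 1. fls_X ^ i :: rat fls)"
    using fls_X_neq_1 by (simp add: divide_eq_eq algebra_simps)
  moreover have "(2 :: rat fls) \<noteq> 0" using regular_nonzero[OF regular_numeral] by auto
  ultimately show ?thesis unfolding phi_def by simp
qed

lemma regular_beta: "L \<ge> 1 \<Longrightarrow> regular 1 (beta L)"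
  unfolding beta_eq_sum by (rule regular_sum_power)

lemma regular_phi: "L \<ge> 1 \<Longrightarrow> regular 1 (2 * phi L * fls_X ^ L)"
  using regular_diff[OF regular_1 regular_mult[OF regular_X regular_sum_power[of "2 * L - 1"]]]
  unfolding phi_mult by simp

text \<open>The leading term is that of \<open>(2 * phi L)^n\<close>: after multiplication by the
  power of \<open>X\<close>, the subtracted term of the recurrence keeps a factor
  \<open>X^2\<close>.\<close>

lemma regular_chebyshev_U:
  assumes "L \<ge> 1"
  shows "regular 1 (chebyshev_U n (phi L) * (fls_X ^ L) ^ n)"
proof -
  define X :: "rat fls" where "X = fls_X ^ L"
  have X: "regular 0 X"
    using regular_power[OF regular_X, of L] assms by (simp add: X_def power_0_left)
  have P: "regular 1 (2 * phi L * X)" using regular_phi[OF assms] by (simp add: X_def)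
  have "regular 1 (chebyshev_U n (phi L) * X ^ n)"
  proof (induction n rule: induct_nat_012)
    case 0
    show ?case using regular_1 by simp
  next
    case 1
    show ?case using P by simp
  next
    case (ge2 n)
    have "chebyshev_U (Suc (Suc n)) (phi L) * X ^ Suc (Suc n) =
        (2 * phi L * X) * (chebyshev_U (Suc n) (phi L) * X ^ Suc n)
        - X * (X * (chebyshev_U n (phi L) * X ^ n))"
      by (simp add: algebra_simps)
    then show ?case
      using regular_diff[OF regular_mult[OF P ge2(2)] regular_mult[OF X regular_mult[OF X ge2(1)]]]
      by simp
  qed
  then show ?thesis by (simp add: X_def)
qed

section \<open>The identity in the field of Laurent series\<close>

text \<open>The first conjunct ensures that the inner quotient is not the default value
  \<open>0\<close> of division by zero.\<close>

theorem theorem3p3: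
  fixes k L :: nat
  assumes "k \<ge> 2" and "L \<ge> 1"
  shows "r4 L * chebyshev_U (k - 1) (phi L) + r5 L * chebyshev_U k (phi L) + r3 L \<noteq> 0 \<and>
    fps_to_fls (staircase_gf k L) =
      beta L / (1 - 2 * fls_X - fls_X ^ L) *
        (1 + (of_nat k - 3) * fls_X +
         fls_X * ((r1 L * chebyshev_U (k - 1) (phi L) + r2 L * chebyshev_U k (phi L) + r3 L) /
                  (r4 L * chebyshev_U (k - 1) (phi L) + r5 L * chebyshev_U k (phi L) + r3 L)))"
proof -
  define x :: "rat fls" where "x = fls_X"
  define X where "X = x ^ L"
  define p where "p = phi L"
  define b where "b = beta L"
  define c where "c = b - 1"
  define u where "u = chebyshev_U (k - 1) p"
  define v where "v = chebyshev_U k p"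
  define D where "D = r4 L * u + r5 L * v + r3 L"
  define N where "N = r1 L * u + r2 L * v + r3 L"
  define D' where "D' = v + c * u + c"
  define e where "e = 1 - 2 * x - X"
  define P where "P = 2 * p * X"
  obtain k' where k': "k = Suc k'" using assms by (cases k) auto
  have x: "regular 0 x" unfolding x_def by (rule regular_X)
  have X: "regular 0 X"
    using regular_power[OF x, of L] assms by (simp add: X_def power_0_left)
  have b: "regular 1 b" unfolding b_def using assms by (intro regular_beta)
  have c: "regular 0 c" using regular_diff[OF b regular_1] by (simp add: c_def)
  have P: "regular 1 P" using regular_phi[OF assms(2)] by (simp add: P_def p_def X_def x_def)
  have uX: "regular 1 (u * X ^ k')" and vX: "regular 1 (v * X ^ k)"
    using regular_chebyshev_U[OF assms(2), of k'] regular_chebyshev_U[OF assms(2), of k]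
    by (simp_all add: u_def v_def X_def x_def p_def k')
  have Xk: "regular 0 (X ^ k)" using regular_power[OF X, of k] by (simp add: k')
  have two: "(2 :: rat fls) \<noteq> 0" using regular_nonzero[OF regular_numeral] by auto
  have x1: "x \<noteq> 1" unfolding x_def by (rule fls_X_neq_1)
  have X0: "X \<noteq> 0" by (simp add: X_def x_def)
  have e0: "e \<noteq> 0"
    using regular_nonzero[OF regular_diff[OF regular_diff[OF regular_1 regular_mult[OF regular_numeral x]] X]]
    by (simp add: e_def)
  have c1: "c ^ 2 \<noteq> 1"
    using regular_nonzero[OF regular_diff[OF regular_1 regular_power[OF c, of 2]]] by auto
  have "D' * X ^ k = v * X ^ k + c * (u * X ^ k') * X + c * X ^ k"
    by (simp add: D'_def k' algebra_simps)
  moreover have "regular (1 + 0 * 1 * 0 + 0 * 0) (v * X ^ k + c * (u * X ^ k') * X + c * X ^ k)"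
    by (intro regular_intros vX uX c X Xk)
  ultimately have D'0: "D' \<noteq> 0" using regular_nonzero by force
  \<comment> \<open>This multiple of \<open>D\<close> has no pole, and its constant term is
    \<open>-1\<close>: the contributions of the \<open>u\<close> part cancel, and
    \<open>- b^2 * P\<close> in the \<open>v\<close> part survives.\<close>
  have "2 * D * X ^ Suc k =
     (2 * (P - 2 * X) * c - b ^ 2 * P) * (v * X ^ k)
     + ((P ^ 2 - 2 * X ^ 2) * b ^ 2 - 2 * (P ^ 2 - P * X - 2 * X ^ 2) * b + P * (P - 2 * X)) * (u * X ^ k')
     + (0 - 2 * (P - 2 * X) * c - 2 * b ^ 2 * X) * X ^ k"
    by (simp add: D_def r3_def r4_def r5_def P_def k' c_def
          p_def[symmetric] b_def[symmetric] algebra_simps power2_eq_square)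
  moreover have "regular ((2 * (1 - 2 * 0) * 0 - 1 ^ 2 * 1) * 1
     + ((1 ^ 2 - 2 * 0 ^ 2) * 1 ^ 2 - 2 * (1 ^ 2 - 1 * 0 - 2 * 0 ^ 2) * 1 + 1 * (1 - 2 * 0)) * 1
     + (0 - 2 * (1 - 2 * 0) * 0 - 2 * 1 ^ 2 * 0) * 0)
     ((2 * (P - 2 * X) * c - b ^ 2 * P) * (v * X ^ k)
     + ((P ^ 2 - 2 * X ^ 2) * b ^ 2 - 2 * (P ^ 2 - P * X - 2 * X ^ 2) * b + P * (P - 2 * X)) * (u * X ^ k')
     + (0 - 2 * (P - 2 * X) * c - 2 * b ^ 2 * X) * X ^ k)"
    by (intro regular_intros regularI[of 0 0, simplified] vX uX c X Xk P b)
  ultimately have D0: "D \<noteq> 0" using regular_nonzero by force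
  have bx: "(1 + c) * (1 - x) = 1 - X"
    by (simp add: c_def b_def beta_eq_sum x_def X_def one_diff_power_eq mult.commute)
  have px: "2 * p * X * (1 - x) = 1 - 2 * x + X ^ 2"
  proof -
    have "(1 - x) * (2 * p * X) = 1 - x - x * (1 - x ^ (2 * L - 1))"
      unfolding p_def X_def x_def phi_mult[OF assms(2)]
      by (simp add: one_diff_power_eq right_diff_distrib mult.left_commute)
    also have "x * (1 - x ^ (2 * L - 1)) = x - x ^ Suc (2 * L - 1)"
      by (simp add: algebra_simps)
    also have "Suc (2 * L - 1) = L * 2" using assms by simp
    finally show ?thesis by (simp add: X_def power_mult algebra_simps)
  qed
  have be: "b * e = 2 * X * (p - 1)"
  proof -
    have "(1 - x) * (b * e) = (1 - X) * e" using bx by (simp add: c_def mult_ac)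
    also have "\<dots> = (1 - x) * (2 * X * (p - 1))"
      using px unfolding e_def by algebra
    finally show ?thesis using x1 by simp
  qed
  have p1: "p - 1 \<noteq> 0" using be e0 regular_nonzero[OF b] by auto
  define A where "A a = fps_to_fls (ext_gf k L (replicate L a))" for a
  define E where "E a b = fps_to_fls (ext_gf k L (b # replicate L a))" for a b
  have A: "A a = 1 + x * (A a + (if a = 1 then 0 else E a (a - 1)) + (if a = k then 0 else E a (a + 1)))"
    if "a \<in> {1..k}" for a
    unfolding A_def using assms(1) arg_cong[OF ext_gf_block[OF assms(2) that], of fps_to_fls]
    by (simp add: fls_times_fps_to_fls E_def x_def split: if_splits)
  \<comment> \<open>The sum in \<open>ext_gf_step\<close> has \<open>L - 1\<close> terms;
    multiplying by \<open>x\<close> makes it \<open>c\<close>.\<close>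
  have cx: "c = x * (\<Sum>i<L-1. x ^ i)"
  proof -
    have "(\<Sum>i<Suc (L-1). x ^ i) = 1 + x * (\<Sum>i<L-1. x ^ i)"
      by (subst sum.lessThan_Suc_shift) (simp add: sum_distrib_left)
    then show ?thesis using assms by (simp add: c_def b_def beta_eq_sum x_def)
  qed
  have XL: "X = x * x ^ (L - 1)" using assms by (simp add: X_def power_eq_if)
  have sum_fls: "fps_to_fls (\<Sum>i<n. fps_X ^ i) = (\<Sum>i<n. x ^ i)" for n
    by (induction n) (simp_all add: x_def fps_to_fls_power)
  have E: "x * E a b = c * (1 + x * E b a) + X * A b"
    if "a \<in> {1..k}" "b \<in> {1..k}" "\<bar>int a - int b\<bar> = 1" for a b
  proof -
    have "E a b = (\<Sum>i<L-1. x ^ i) * (1 + x * E b a) + x ^ (L - 1) * A b"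
      unfolding E_def A_def ext_gf_step[OF that(3,1,2) assms(2)]
      by (simp add: fls_times_fps_to_fls fps_to_fls_power sum_fls x_def)
    then show ?thesis unfolding cx XL by (simp add: algebra_simps)
  qed
  have f: "fps_to_fls (staircase_gf k L) = 1 + x * (\<Sum>a=1..k. A a)"
  proof -
    have "fps_to_fls (\<Sum>a\<in>S. F a) = (\<Sum>a\<in>S. fps_to_fls (F a))" for S and F :: "nat \<Rightarrow> rat fps"
      by (induction S rule: infinite_finite_induct) simp_all
    then show ?thesis
      unfolding staircase_gf_eq_ext_gf ext_gf_start[OF assms(2)]
      by (simp add: fls_times_fps_to_fls A_def x_def)
  qed
  have b1: "b = 1 + c" by (simp add: c_def)
  have sum_A: "e * (\<Sum>a=1..k. A a) = of_nat k * b - (2 * (p - 1) * c + b ^ 2) * (v - u - 1) / ((p - 1) * D')"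
    unfolding e_def b1 D'_def u_def v_def
    using assms D'0 e0
    by (intro coupled_system_sum[OF two _ A E bx px x1 X0 c1]) (auto simp: D'_def e_def u_def v_def)
  have "v ^ 2 - 2 * p * u * v + u ^ 2 = 1"
    using chebyshev_U_Pell[of k' p] by (simp add: u_def v_def k')
  from denominators_agree[OF this, of b]
  have "(p - 1) * D' * (b * N - 2 * c * D) = r3 L * (v - u - 1) * D"
    unfolding D'_def N_def D_def r1_def r2_def r3_def r4_def r5_def
    by (simp only: p_def[symmetric] b_def[symmetric] c_def)
  then have "r3 L * (v - u - 1) / ((p - 1) * D') = (b * N - 2 * c * D) / D"
    using p1 D'0 D0 by (subst frac_eq_eq) (simp_all only: mult_ac mult_eq_0_iff simp_thms)
  moreover have "2 * (p - 1) * c + b ^ 2 = - r3 L"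
    by (simp add: r3_def p_def b_def c_def algebra_simps)
  ultimately have "e * (\<Sum>a=1..k. A a) = of_nat k * b + (b * N - 2 * c * D) / D"
    using sum_A by simp
  then have sum_A': "e * (\<Sum>a=1..k. A a) = of_nat k * b + b * (N / D) - 2 * c"
    using D0 by (simp add: diff_divide_distrib)
  \<comment> \<open>This absorbs the initial \<open>1\<close> of \<open>f\<close> and the stray
    \<open>- 2 * c\<close> of \<open>sum_A'\<close> into the factor \<open>b\<close>, and is the
    source of the \<open>- 3\<close> in the formula.\<close>
  have "e - 2 * c * x = b * (1 - 3 * x)"
    using bx unfolding e_def b1 by algebra
  then have "e * (1 + x * (\<Sum>a=1..k. A a)) = b * (1 + (of_nat k - 3) * x + x * (N / D))"
    using sum_A' by algebra
  then have "1 + x * (\<Sum>a=1..k. A a) = b / e * (1 + (of_nat k - 3) * x + x * (N / D))"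
    using e0 by (simp add: field_simps)
  with D0 show ?thesis
    unfolding f D_def N_def u_def v_def e_def X_def x_def b_def p_def by blast
qed

end
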